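(* Let $n\ge2$ and $d\ge1$ be integers, $\mu\in\mathbb{R}^d$ with $\mu\ne0$, $\sigma>0$, let $F=\{f_k\}_{k=0}^{\binom n2}$ be a set of functions $f_k:\{0,1\}^k\to(0,1]$, and let $(\tau_{ij})_{i<j}$ be predecessor sets. Let $(Y^\ast,A)$ be generated by the Dynamic Latent Space Model with parameters $(d,\mu,\sigma,F)$ on $n$ nodes with these predecessor sets. If $$(4\sigma^2 + 1)^{-1-d/2}\, \Vert\mu\Vert_2^2 \leq \frac{n-2}{4(n^2 - n)}\, \log 2,$$ then for every (possibly randomized) estimator $\hat Y$ of $Y^\ast$ based on $A$ (the latent vectors are not observed), i.e. every random $\hat Y\in\{+1,-1\}^n$ such that $Y^\ast\to A\to\hat Y$ is a Markov chain, we have $$\mathbb{P}(\hat Y\neq Y^\ast)\ \geq\ \frac12 .$$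
   Context: Predecessor sets: for each pair $1\le i<j\le n$, $\tau_{ij}$ is a fixed set with $$\tau_{ij}\subseteq\{(k,l)\mid (k<l)\wedge (k<i\ \vee\ (k=i\wedge l<j))\},$$ i.e. a set of pairs preceding $(i,j)$ in lexicographic order, and $A_{\tau_{ij}}=\{A_{kl}\mid (k,l)\in\tau_{ij}\}$, regarded as a vector in $\{0,1\}^{|\tau_{ij}|}$ (entries listed in lexicographic order of the pairs). Dynamic Latent Space Model with parameters $(d,\mu,\sigma,F)$: a random undirected graph on nodes $1,\dots,n$ with adjacency entries $A_{ij}\in\{0,1\}$, $i<j$. The true label vector $Y^\ast=(y^\ast_1,\dots,y^\ast_n)$ is uniform on $\{+1,-1\}^n$. Conditionally on $Y^\ast$, latent vectors $z_1,\dots,z_n\in\mathbb{R}^d$ are independent with $z_i\sim N_d(y^\ast_i\mu,\sigma^2I)$, where $I$ is the $d\times d$ identity matrix. Given $Y^\ast$ and the latent vectors, the entries $A_{ij}$ are generated sequentially in lexicographic order of $(i,j)$: conditionally on $Y^\ast$, the latent vectors and all previously generated entries, $A_{ij}$ is Bernoulli with parameter $f_{|\tau_{ij}|}(A_{\tau_{ij}})\cdot\exp(-\Vert z_i-z_j\Vert_2^2)$. $\log$ is the natural logarithm. The Markov chain condition means that $\hat Y$ is conditionally independent of $Y^\ast$ given $A$. *)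

theory Defs
  imports "HOL-Probability.Probability"
begin

text \<open>Nodes are the numbers \<open>1, \<dots>, n\<close>. A label vector is an element of \<open>{+1,-1}\<close> to the power \<open>n\<close>,
  encoded as an extensional function on \<open>{1..n}\<close>.\<close>

definition labels :: "nat \<Rightarrow> (nat \<Rightarrow> real) set" where
  "labels n = {1..n} \<rightarrow>\<^sub>E {1, -1}"

text \<open>The pairs \<open>(i, j)\<close> with \<open>1 \<le> i < j \<le> n\<close>, listed in lexicographic order.\<close>

definition edge_pairs :: "nat \<Rightarrow> (nat \<times> nat) list" where
  "edge_pairs n = [(i, j). i \<leftarrow> [1..<n+1], j \<leftarrow> [i+1..<n+1]]"

text \<open>An undirected graph is given by its entries above the diagonal; \<open>True\<close> stands for \<open>1\<close>.\<close>

type_synonym adjacency = "nat \<times> nat \<Rightarrow> bool"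

definition graphs :: "nat \<Rightarrow> adjacency set" where
  "graphs n = set (edge_pairs n) \<rightarrow>\<^sub>E UNIV"

text \<open>The bounds \<open>1 \<le> k\<close> and \<open>l \<le> n\<close> say that predecessors are themselves node pairs.\<close>

definition predecessor_sets :: "nat \<Rightarrow> (nat \<Rightarrow> nat \<Rightarrow> (nat \<times> nat) set) \<Rightarrow> bool" where
  "predecessor_sets n \<tau> \<longleftrightarrow>
    (\<forall>i j. 1 \<le> i \<and> i < j \<and> j \<le> n \<longrightarrow>
      \<tau> i j \<subseteq> {(k, l). 1 \<le> k \<and> k < l \<and> l \<le> n \<and> (k < i \<or> (k = i \<and> l < j))})"

text \<open>A family \<open>f\<^sub>k : {0,1}\<^sup>k \<rightarrow> (0,1]\<close>; the vectors in \<open>{0,1}\<^sup>k\<close> are the Boolean lists of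
  length \<open>k\<close>, and values at lists of another length are irrelevant.\<close>

definition link_family :: "nat \<Rightarrow> (nat \<Rightarrow> bool list \<Rightarrow> real) \<Rightarrow> bool" where
  "link_family n f \<longleftrightarrow>
    (\<forall>k \<le> n choose 2. \<forall>x. length x = k \<longrightarrow> 0 < f k x \<and> f k x \<le> 1)"

text \<open>The vector of the entries indexed by \<open>S\<close>, in lexicographic order of the pairs.\<close>

definition entries :: "nat \<Rightarrow> adjacency \<Rightarrow> (nat \<times> nat) set \<Rightarrow> bool list" where
  "entries n a S = map a (filter (\<lambda>p. p \<in> S) (edge_pairs n))"

text \<open>The Gaussian \<open>N\<^sub>d(m, \<sigma>\<^sup>2 I)\<close>; the library density takes the standard deviation.\<close>

definition gaussian :: "real ^ 'd \<Rightarrow> real \<Rightarrow> (real ^ 'd) measure" where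
  "gaussian m \<sigma> = density lborel (\<lambda>x. ennreal (\<Prod>c\<in>UNIV. normal_density (m $ c) \<sigma> (x $ c)))"

text \<open>Sequential generation of the entries at the listed pairs, given the latent vectors \<open>z\<close>
  and the entries \<open>a\<close> generated so far.\<close>

fun generate ::
  "nat \<Rightarrow> (nat \<Rightarrow> bool list \<Rightarrow> real) \<Rightarrow> (nat \<Rightarrow> nat \<Rightarrow> (nat \<times> nat) set) \<Rightarrow> (nat \<Rightarrow> real ^ 'd)
    \<Rightarrow> (nat \<times> nat) list \<Rightarrow> adjacency \<Rightarrow> adjacency pmf" where
  "generate n f \<tau> z [] a = return_pmf a"
| "generate n f \<tau> z ((i, j) # ps) a =
    bind_pmf
      (bernoulli_pmf (f (card (\<tau> i j)) (entries n a (\<tau> i j)) * exp (- (norm (z i - z j))\<^sup>2)))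
      (\<lambda>b. generate n f \<tau> z ps (a((i, j) := b)))"

text \<open>The joint law of the label vector and the graph, with the latent vectors integrated out.
  As \<open>\<lambda>_. undefined\<close> is the extensional function with empty domain, it represents the state in
  which no entry has been generated yet.\<close>

definition dlsm_law ::
  "nat \<Rightarrow> real ^ 'd \<Rightarrow> real \<Rightarrow> (nat \<Rightarrow> bool list \<Rightarrow> real) \<Rightarrow> (nat \<Rightarrow> nat \<Rightarrow> (nat \<times> nat) set)
    \<Rightarrow> ((nat \<Rightarrow> real) \<times> adjacency) measure" where
  "dlsm_law n \<mu> \<sigma> f \<tau> =
    bind (measure_pmf (pmf_of_set (labels n))) (\<lambda>y.
      bind (PiM {1..n} (\<lambda>i. gaussian (y i *\<^sub>R \<mu>) \<sigma>)) (\<lambda>z.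
        measure_pmf (map_pmf (Pair y) (generate n f \<tau> z (edge_pairs n) (\<lambda>_. undefined)))))"

definition dynamic_latent_space_model ::
  "'w measure \<Rightarrow> nat \<Rightarrow> real ^ 'd \<Rightarrow> real \<Rightarrow> (nat \<Rightarrow> bool list \<Rightarrow> real)
    \<Rightarrow> (nat \<Rightarrow> nat \<Rightarrow> (nat \<times> nat) set) \<Rightarrow> ('w \<Rightarrow> nat \<Rightarrow> real) \<Rightarrow> ('w \<Rightarrow> adjacency) \<Rightarrow> bool" where
  "dynamic_latent_space_model M n \<mu> \<sigma> f \<tau> Y A \<longleftrightarrow>
    Y \<in> measurable M (count_space (labels n)) \<and>
    A \<in> measurable M (count_space (graphs n)) \<and>
    distr M (count_space UNIV) (\<lambda>\<omega>. (Y \<omega>, A \<omega>)) = dlsm_law n \<mu> \<sigma> f \<tau>"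

text \<open>The Markov chain condition \<open>X \<rightarrow> Y \<rightarrow> Z\<close> for random variables with finitely many values.
  If \<open>Y = y\<close> has probability \<open>0\<close>, the conditional probabilities are \<open>0\<close> and nothing is required.\<close>

definition markov_chain :: "'w measure \<Rightarrow> ('w \<Rightarrow> 'x) \<Rightarrow> ('w \<Rightarrow> 'y) \<Rightarrow> ('w \<Rightarrow> 'z) \<Rightarrow> bool" where
  "markov_chain M X Y Z \<longleftrightarrow>
    (\<forall>x y z. \<P>(\<omega> in M. X \<omega> = x \<and> Z \<omega> = z \<bar> Y \<omega> = y) =
      \<P>(\<omega> in M. X \<omega> = x \<bar> Y \<omega> = y) * \<P>(\<omega> in M. Z \<omega> = z \<bar> Y \<omega> = y))"

end

(* The distances between the latent vectors, hence the law of the graph, do not change when every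
   latent vector is reflected in the origin, and the reflection turns the label vector y into -y.
   So (Y, A) and (-Y, A) have the same law, and by the Markov property this stays true jointly with
   Yhat. Hence
   P(Yhat = Y) = P(Yhat = -Y) <= P(Yhat \<noteq> Y), that is, the error 1/2 comes from the ambiguity of
   the global sign alone. *)
theory Submission
  imports Defs
begin

section \<open>Label vectors and their global sign flip\<close>

lemma finite_labels: "finite (labels n)"
  unfolding labels_def by (intro finite_PiE) auto

lemma labels_nonempty: "labels n \<noteq> {}"
  unfolding labels_def by (simp add: PiE_eq_empty_iff)

lemma finite_graphs: "finite (graphs n)"
  unfolding graphs_def by (intro finite_PiE) auto

text \<open>\<open>restrict\<close> keeps the negated vector extensional and hence inside
  \<open>labels n\<close>; plain negation would also act on the default value
  \<open>undefined\<close> outside \<open>{1..n}\<close>.\<close>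

definition flip_labels :: "nat \<Rightarrow> (nat \<Rightarrow> real) \<Rightarrow> nat \<Rightarrow> real" where
  "flip_labels n y = restrict (\<lambda>i. - y i) {1..n}"

lemma flip_labels_in: "y \<in> labels n \<Longrightarrow> flip_labels n y \<in> labels n"
  unfolding labels_def flip_labels_def by fastforce

lemma flip_labels_flip_labels: "y \<in> labels n \<Longrightarrow> flip_labels n (flip_labels n y) = y"
  unfolding labels_def flip_labels_def
  by (auto simp: fun_eq_iff PiE_def extensional_def)

text \<open>Node 1 carries a nonzero label, which changes sign. For \<open>n = 0\<close> the only
  label vector is its own flip. This is what makes guessing right and guessing the flipped vector
  exclude each other.\<close>

lemma flip_labels_neq:
  assumes "y \<in> labels n" "n \<ge> 1"
  shows "flip_labels n y \<noteq> y"
proof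
  assume "flip_labels n y = y"
  then have "- y 1 = y 1"
    using assms(2) by (metis atLeastAtMost_iff flip_labels_def order_refl restrict_apply')
  moreover have "y 1 \<in> {1, -1}"
    using assms unfolding labels_def by (metis PiE_mem atLeastAtMost_iff order_refl)
  ultimately show False by auto
qed

text \<open>An involution permutes the finite set \<open>labels n\<close>, and a permutation
  preserves the uniform distribution.\<close>

lemma map_flip_labels: "map_pmf (flip_labels n) (pmf_of_set (labels n)) = pmf_of_set (labels n)"
proof (rule map_pmf_of_set_bij_betw)
  show "bij_betw (flip_labels n) (labels n) (labels n)"
    by (rule bij_betw_byWitness[where f' = "flip_labels n"])
      (auto simp: flip_labels_in flip_labels_flip_labels)
qed (auto simp: finite_labels labels_nonempty)

section \<open>Isotropic Gaussian vectors and their reflection\<close>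

lemma sets_gaussian [measurable_cong, simp]: "sets (gaussian m \<sigma>) = sets borel"
  by (simp add: gaussian_def)

lemma gaussian_density_measurable [measurable]:
  fixes m :: "real ^ 'd"
  shows "(\<lambda>x::real ^ 'd. \<Prod>c\<in>UNIV. normal_density (m $ c) \<sigma> (x $ c)) \<in> borel_measurable borel"
  by (intro borel_measurable_prod measurable_compose[OF _ borel_measurable_normal_density]
      borel_measurable_continuous_onI) (intro continuous_intros)

lemma prob_space_gaussian:
  fixes m :: "real ^ 'd"
  assumes "\<sigma> > 0"
  shows "prob_space (gaussian m \<sigma>)"
proof
  have Basis: "(Basis :: (real ^ 'd) set) = range (\<lambda>c. axis c 1)"
    by (auto simp: Basis_vec_def)
  have inj: "inj (\<lambda>c::'d. axis c (1::real))"
    by (auto simp: inj_on_def axis_eq_axis)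
  have normal: "(\<integral>\<^sup>+x. ennreal (normal_density u \<sigma> x) \<partial>lborel) = 1" for u
    using prob_space.emeasure_space_1[OF prob_space_normal_density[OF assms, of u]]
    by (simp add: emeasure_density)
  have "emeasure (gaussian m \<sigma>) (space (gaussian m \<sigma>)) =
      (\<integral>\<^sup>+x. (\<Prod>c\<in>UNIV. ennreal (normal_density (m $ c) \<sigma> (x $ c))) \<partial>lborel)"
    unfolding gaussian_def by (simp add: emeasure_density prod_ennreal)
  \<comment> \<open>Coordinates become inner products with the standard basis vectors, the form in
    which the Lebesgue integral of a product factorises into one-dimensional integrals.\<close>
  also have "\<dots> =
      (\<integral>\<^sup>+x. (\<Prod>b\<in>Basis. ennreal (normal_density (m \<bullet> b) \<sigma> (x \<bullet> b))) \<partial>lborel)"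
    unfolding Basis by (simp add: prod.reindex[OF inj] inner_axis)
  also have "\<dots> = 1"
    by (subst nn_integral_lborel_prod) (simp_all add: normal)
  finally show "emeasure (gaussian m \<sigma>) (space (gaussian m \<sigma>)) = 1" .
qed

text \<open>Lebesgue measure is invariant under reflection in the origin, and the normal density
  sees only the squared distance to the mean, so negating both point and mean changes
  nothing.\<close>

lemma distr_gaussian_uminus:
  fixes m :: "real ^ 'd"
  shows "distr (gaussian m \<sigma>) borel uminus = gaussian (- m) \<sigma>"
proof -
  \<comment> \<open>The affine map with factor -1 and shift 0 has Jacobian of absolute value
    1.\<close>
  have lborel: "distr lborel borel uminus = (lborel :: (real ^ 'd) measure)"
    by (subst lborel_affine[of "-1" "0 :: real ^ 'd"])
      (auto simp: density_1 one_ennreal_def[symmetric] distr_distr comp_def)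
  have "gaussian (- m) \<sigma> = density (distr lborel borel uminus)
      (\<lambda>x. ennreal (\<Prod>c\<in>UNIV. normal_density ((- m) $ c) \<sigma> (x $ c)))"
    by (simp add: gaussian_def lborel)
  also have "\<dots> = distr (density lborel
      (\<lambda>x. ennreal (\<Prod>c\<in>UNIV. normal_density ((- m) $ c) \<sigma> ((- x) $ c)))) borel uminus"
    by (rule density_distr) simp_all
  also have "\<dots> = distr (gaussian m \<sigma>) borel uminus"
    by (simp add: gaussian_def normal_density_def power2_commute)
  finally show ?thesis ..
qed

section \<open>The generated graph as a function of the latent vectors\<close>

lemma generate_cong:
  assumes "\<And>i j. (i, j) \<in> set ps \<Longrightarrow> norm (z i - z j) = norm (z' i - z' j)"
  shows "generate n f \<tau> z ps a = generate n f \<tau> z' ps a"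
  using assms
proof (induction ps arbitrary: a)
  case (Cons p ps)
  then show ?case by (cases p) simp
qed simp

text \<open>By induction on the pairs still to be generated: each entry splits the probability into
  two terms whose weights depend measurably on \<open>z i\<close> and \<open>z j\<close>. The
  assumption on \<open>ps\<close> makes these coordinates measurable projections.\<close>

lemma emeasure_generate_measurable:
  fixes X :: "adjacency set"
  assumes "set ps \<subseteq> I \<times> I"
  shows "(\<lambda>z. emeasure (generate n f \<tau> z ps a) X) \<in>
    borel_measurable (Pi\<^sub>M I (\<lambda>i. borel :: (real ^ 'd) measure))"
  using assms
proof (induction ps arbitrary: a)
  case Nil
  then show ?case by simp
next
  case (Cons p ps)
  obtain i j where p: "p = (i, j)" by force
  have [measurable]: "i \<in> I" "j \<in> I" using Cons.prems p by auto
  have [measurable]: "(\<lambda>z. emeasure (generate n f \<tau> z ps b) X) \<in>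
      borel_measurable (Pi\<^sub>M I (\<lambda>i. borel :: (real ^ 'd) measure))" for b
    using Cons by auto
  have "emeasure (generate n f \<tau> z (p # ps) a) X =
      (\<Sum>b\<in>UNIV. emeasure (generate n f \<tau> z ps (a((i, j) := b))) X *
        pmf (bernoulli_pmf (f (card (\<tau> i j)) (entries n a (\<tau> i j))
          * exp (- (norm (z i - z j))\<^sup>2))) b)" for z :: "nat \<Rightarrow> real ^ 'd"
    unfolding p generate.simps emeasure_bind_pmf
    by (subst nn_integral_measure_pmf_support[where A = UNIV]) auto
  \<comment> \<open>\<open>bernoulli_pmf\<close> clips its parameter to the unit interval, so each
    weight is a minimum and maximum of measurable functions, up to the complement for
    \<open>False\<close>.\<close>
  moreover have "(\<lambda>z. pmf (bernoulli_pmf (c * exp (- (norm (z i - z j))\<^sup>2))) b) \<in>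
      borel_measurable (Pi\<^sub>M I (\<lambda>i. borel :: (real ^ 'd) measure))" for c b
    by (cases b) (simp_all add: bernoulli_pmf.rep_eq)
  ultimately show ?case by simp
qed

lemma set_edge_pairs_subset: "set (edge_pairs n) \<subseteq> {1..n} \<times> {1..n}"
  by (auto simp: edge_pairs_def)

lemma generate_kernel_measurable:
  "(\<lambda>z. measure_pmf (map_pmf g (generate n f \<tau> z (edge_pairs n) a))) \<in>
    measurable (Pi\<^sub>M {1..n} (\<lambda>i. borel :: (real ^ 'd) measure)) (subprob_algebra (count_space UNIV))"
  by (rule measurable_subprob_algebra)
    (simp_all add: subprob_space_measure_pmf
      emeasure_generate_measurable[OF set_edge_pairs_subset] del: One_nat_def)

section \<open>Invariance of the joint law under the sign flip\<close>

lemma PiM_gaussian_flip: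
  fixes \<mu> :: "real ^ 'd"
  assumes "\<sigma> > 0"
  shows "Pi\<^sub>M {1..n} (\<lambda>i. gaussian (flip_labels n y i *\<^sub>R \<mu>) \<sigma>) =
    distr (Pi\<^sub>M {1..n} (\<lambda>i. gaussian (y i *\<^sub>R \<mu>) \<sigma>)) (Pi\<^sub>M {1..n} (\<lambda>_. borel))
      (compose {1..n} uminus)"
proof -
  have "distr (Pi\<^sub>M {1..n} (\<lambda>i. gaussian (y i *\<^sub>R \<mu>) \<sigma>))
        (Pi\<^sub>M {1..n} (\<lambda>i. gaussian (flip_labels n y i *\<^sub>R \<mu>) \<sigma>)) (compose {1..n} uminus) =
      Pi\<^sub>M {1..n} (\<lambda>i. distr (gaussian (y i *\<^sub>R \<mu>) \<sigma>) (gaussian (flip_labels n y i *\<^sub>R \<mu>) \<sigma>) uminus)"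
    by (rule distr_PiM_finite_prob_space') (auto simp: prob_space_gaussian assms)
  also have "\<dots> = Pi\<^sub>M {1..n} (\<lambda>i. gaussian (flip_labels n y i *\<^sub>R \<mu>) \<sigma>)"
  proof (rule PiM_cong)
    fix i assume "i \<in> {1..n}"
    then have "distr (gaussian (y i *\<^sub>R \<mu>) \<sigma>) borel uminus = gaussian (flip_labels n y i *\<^sub>R \<mu>) \<sigma>"
      by (simp add: distr_gaussian_uminus flip_labels_def)
    then show "distr (gaussian (y i *\<^sub>R \<mu>) \<sigma>) (gaussian (flip_labels n y i *\<^sub>R \<mu>) \<sigma>) uminus =
        gaussian (flip_labels n y i *\<^sub>R \<mu>) \<sigma>"
      by (simp cong: distr_cong)
  qed simp
  \<comment> \<open>The Gaussian factors carry the Borel sets, so the target of the pushforward may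
    be exchanged for the product of Borel spaces.\<close>
  moreover have "sets (Pi\<^sub>M {1..n} (\<lambda>i. gaussian (flip_labels n y i *\<^sub>R \<mu>) \<sigma>)) =
      sets (Pi\<^sub>M {1..n} (\<lambda>_. borel))"
    by (intro sets_PiM_cong) auto
  ultimately show ?thesis by (simp cong: distr_cong)
qed

text \<open>The flip symmetry of (Y, A): reflecting all latent vectors exchanges the latent laws for
  a label vector and its flip while the graph kernel stays the same, and the label prior is itself
  invariant.\<close>

lemma distr_dlsm_law_flip:
  fixes \<mu> :: "real ^ 'd"
  assumes "\<sigma> > 0"
  shows "distr (dlsm_law n \<mu> \<sigma> f \<tau>) (count_space UNIV) (map_prod (flip_labels n) id) =
    dlsm_law n \<mu> \<sigma> f \<tau>"
proof -
  define P where "P y = Pi\<^sub>M {1..n} (\<lambda>i. gaussian (y i *\<^sub>R \<mu>) \<sigma>)" for y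
  define G where "G z = generate n f \<tau> z (edge_pairs n) (\<lambda>_. undefined)" for z :: "nat \<Rightarrow> real ^ 'd"
  define K where "K y = P y \<bind> (\<lambda>z. measure_pmf (map_pmf (Pair y) (G z)))" for y
  have law: "dlsm_law n \<mu> \<sigma> f \<tau> = measure_pmf (pmf_of_set (labels n)) \<bind> K"
    by (simp add: dlsm_law_def P_def G_def K_def[abs_def])
  have sets_P: "sets (P y) = sets (Pi\<^sub>M {1..n} (\<lambda>_. borel))" for y
    unfolding P_def by (intro sets_PiM_cong) auto
  have prob_P: "prob_space (P y)" for y
    unfolding P_def by (intro prob_space_PiM prob_space_gaussian assms)
  have kernel: "(\<lambda>z. measure_pmf (map_pmf g (G z))) \<in>
      measurable (P y) (subprob_algebra (count_space UNIV))" for y and g :: "adjacency \<Rightarrow> 'z"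
    using generate_kernel_measurable measurable_cong_sets[OF sets_P refl] unfolding G_def by blast
  have meas_G: "(\<lambda>z. emeasure (G z) B) \<in> borel_measurable (Pi\<^sub>M {1..n} (\<lambda>_. borel))" for B
    unfolding G_def by (intro emeasure_generate_measurable set_edge_pairs_subset)
  have K_space: "K y \<in> space (subprob_algebra (count_space UNIV))" for y
  proof -
    interpret prob_space "P y" by (rule prob_P)
    have "subprob_space (K y)"
      unfolding K_def by (rule subprob_space_bind[OF _ kernel]) unfold_locales
    moreover have "sets (K y) = sets (count_space UNIV)"
      unfolding K_def using kernel by (rule sets_bind[OF sets_kernel]) (auto simp: not_empty)
    ultimately show ?thesis by (simp add: space_subprob_algebra)
  qed
  \<comment> \<open>Under \<open>K y\<close> the label component is the constant \<open>y\<close>,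
    so only the section of \<open>X\<close> at \<open>y\<close> counts. The symmetry then reduces to
    events \<open>B\<close> about the graph alone.\<close>
  have em_K: "emeasure (K y) X = (\<integral>\<^sup>+z. emeasure (G z) (Pair y -` X) \<partial>P y)" for y X
    unfolding K_def
    by (subst emeasure_bind[OF _ kernel]) (auto simp: prob_P prob_space.not_empty)
  have em_law: "emeasure (dlsm_law n \<mu> \<sigma> f \<tau>) X =
      (\<integral>\<^sup>+y. emeasure (K y) X \<partial>measure_pmf (pmf_of_set (labels n)))" for X
    unfolding law by (subst emeasure_bind[where N = "count_space UNIV"]) (auto simp: K_space)
  have sets_law: "sets (dlsm_law n \<mu> \<sigma> f \<tau>) = UNIV"
    unfolding law using K_space
    by (subst sets_bind[where N = "count_space UNIV"]) (auto simp: space_subprob_algebra)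
  \<comment> \<open>Substitute the reflected vectors for \<open>z\<close>; the integrand is
    unchanged because \<open>G\<close> depends on \<open>z\<close> only through pairwise
    distances.\<close>
  have flip: "(\<integral>\<^sup>+z. emeasure (G z) B \<partial>P (flip_labels n y)) = (\<integral>\<^sup>+z. emeasure (G z) B \<partial>P y)"
    for y B
  proof -
    have reflect: "G (compose {1..n} uminus z) = G z" for z
      unfolding G_def
    proof (rule generate_cong)
      fix i j assume "(i, j) \<in> set (edge_pairs n)"
      then have "i \<in> {1..n}" "j \<in> {1..n}" using set_edge_pairs_subset by blast+
      then show "norm (compose {1..n} uminus z i - compose {1..n} uminus z j) = norm (z i - z j)"
        by (simp add: compose_def norm_minus_commute)
    qed
    have "compose {1..n} uminus \<in> measurable (P y) (Pi\<^sub>M {1..n} (\<lambda>_. borel :: (real ^ 'd) measure))"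
      unfolding compose_def measurable_cong_sets[OF sets_P refl] by measurable
    then have "(\<integral>\<^sup>+z. emeasure (G z) B \<partial>P (flip_labels n y)) =
        (\<integral>\<^sup>+z. emeasure (G (compose {1..n} uminus z)) B \<partial>P y)"
      unfolding P_def PiM_gaussian_flip[OF assms]
      by (intro nn_integral_distr) (simp_all add: meas_G del: One_nat_def)
    then show ?thesis unfolding reflect .
  qed
  show ?thesis
  proof (rule measure_eqI)
    fix X :: "((nat \<Rightarrow> real) \<times> adjacency) set"
    have "emeasure (distr (dlsm_law n \<mu> \<sigma> f \<tau>) (count_space UNIV) (map_prod (flip_labels n) id)) X =
        emeasure (dlsm_law n \<mu> \<sigma> f \<tau>) (map_prod (flip_labels n) id -` X)"
      using sets_law sets_eq_imp_space_eq[of "dlsm_law n \<mu> \<sigma> f \<tau>" "count_space UNIV"]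
      by (subst emeasure_distr) (auto simp: measurable_def)
    \<comment> \<open>The preimage of \<open>X\<close> has at \<open>y\<close> the section of
      \<open>X\<close> at \<open>flip_labels n y\<close>; by \<open>flip\<close> its latent integral
      may be taken under the flipped labels as well.\<close>
    also have "\<dots> = (\<integral>\<^sup>+y. emeasure (K (flip_labels n y)) X \<partial>measure_pmf (pmf_of_set (labels n)))"
      unfolding em_law
      by (intro nn_integral_cong) (simp add: em_K flip vimage_def)
    also have "\<dots> = (\<integral>\<^sup>+y. emeasure (K y) X
        \<partial>measure_pmf (map_pmf (flip_labels n) (pmf_of_set (labels n))))"
      by simp
    also have "\<dots> = emeasure (dlsm_law n \<mu> \<sigma> f \<tau>) X"
      unfolding map_flip_labels em_law ..
    finally show "emeasure (distr (dlsm_law n \<mu> \<sigma> f \<tau>) (count_space UNIV)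
        (map_prod (flip_labels n) id)) X = emeasure (dlsm_law n \<mu> \<sigma> f \<tau>) X" .
  qed (simp add: sets_law)
qed

section \<open>From the symmetry of the law to the error bound\<close>

theorem theorem4:
  fixes n :: nat
    and \<mu> :: "real ^ 'd"
    and \<sigma> :: real
    and f :: "nat \<Rightarrow> bool list \<Rightarrow> real"
    and \<tau> :: "nat \<Rightarrow> nat \<Rightarrow> (nat \<times> nat) set"
    and M :: "'w measure"
    and Y Yhat :: "'w \<Rightarrow> nat \<Rightarrow> real"
    and A :: "'w \<Rightarrow> adjacency"
  assumes "n \<ge> 2" and "\<mu> \<noteq> 0" and "\<sigma> > 0"
    and "link_family n f"
    and "predecessor_sets n \<tau>"
    and "prob_space M"
    and "dynamic_latent_space_model M n \<mu> \<sigma> f \<tau> Y A"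
    and "(4 * \<sigma>\<^sup>2 + 1) powr (- 1 - real CARD('d) / 2) * (norm \<mu>)\<^sup>2
      \<le> (real n - 2) / (4 * ((real n)\<^sup>2 - real n)) * ln 2"
    and "Yhat \<in> measurable M (count_space (labels n))"
    and "markov_chain M Y A Yhat"
  shows "\<P>(\<omega> in M. Yhat \<omega> \<noteq> Y \<omega>) \<ge> 1 / 2"
proof -
  interpret prob_space M by fact
  have Y: "Y \<in> measurable M (count_space (labels n))"
    and A: "A \<in> measurable M (count_space (graphs n))"
    and law: "distr M (count_space UNIV) (\<lambda>\<omega>. (Y \<omega>, A \<omega>)) = dlsm_law n \<mu> \<sigma> f \<tau>"
    using assms(7) by (auto simp: dynamic_latent_space_model_def)
  note Yhat = assms(9)
  have in_labels: "Y \<omega> \<in> labels n" "Yhat \<omega> \<in> labels n" "A \<omega> \<in> graphs n" if "\<omega> \<in> space M" for \<omega>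
    using measurable_space[OF Y that] measurable_space[OF Yhat that] measurable_space[OF A that]
    by auto
  define R where "R = labels n \<times> graphs n \<times> labels n"
  have triple: "(\<lambda>\<omega>. (Y \<omega>, A \<omega>, Yhat \<omega>)) \<in> measurable M (count_space R)"
  proof (rule measurable_count_space_eq2[THEN iffD2], safe)
    show "finite R" by (simp add: R_def finite_labels finite_graphs)
    fix y a z assume "(y, a, z) \<in> R"
    then have "Y -` {y} \<inter> space M \<in> events" "A -` {a} \<inter> space M \<in> events"
        "Yhat -` {z} \<inter> space M \<in> events"
      by (auto simp: R_def intro!: measurable_sets[OF Y] measurable_sets[OF A] measurable_sets[OF Yhat])
    then have "(Y -` {y} \<inter> space M) \<inter> (A -` {a} \<inter> space M) \<inter> (Yhat -` {z} \<inter> space M) \<in> events"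
      by blast
    also have "(Y -` {y} \<inter> space M) \<inter> (A -` {a} \<inter> space M) \<inter> (Yhat -` {z} \<inter> space M) =
        (\<lambda>\<omega>. (Y \<omega>, A \<omega>, Yhat \<omega>)) -` {(y, a, z)} \<inter> space M" by auto
    finally show "(\<lambda>\<omega>. (Y \<omega>, A \<omega>, Yhat \<omega>)) -` {(y, a, z)} \<inter> space M \<in> events" .
  qed (auto simp: R_def in_labels)
  \<comment> \<open>The triple is measurable into a finite discrete space, so every predicate of it
    defines an event.\<close>
  have event: "{\<omega> \<in> space M. Q (Y \<omega>) (A \<omega>) (Yhat \<omega>)} \<in> events" for Q
  proof -
    have "(\<lambda>\<omega>. (Y \<omega>, A \<omega>, Yhat \<omega>)) -` {(y, a, z) \<in> R. Q y a z} \<inter> space M \<in> events"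
      by (intro measurable_sets[OF triple]) auto
    also have "(\<lambda>\<omega>. (Y \<omega>, A \<omega>, Yhat \<omega>)) -` {(y, a, z) \<in> R. Q y a z} \<inter> space M =
        {\<omega> \<in> space M. Q (Y \<omega>) (A \<omega>) (Yhat \<omega>)}"
      by (auto simp: R_def in_labels)
    finally show ?thesis .
  qed
  have pair: "(\<lambda>\<omega>. (Y \<omega>, A \<omega>)) \<in> measurable M (count_space UNIV)"
  proof (rule measurableI)
    fix X :: "((nat \<Rightarrow> real) \<times> adjacency) set"
    have "(\<lambda>\<omega>. (Y \<omega>, A \<omega>)) -` X \<inter> space M = {\<omega> \<in> space M. (Y \<omega>, A \<omega>) \<in> X}" by auto
    then show "(\<lambda>\<omega>. (Y \<omega>, A \<omega>)) -` X \<inter> space M \<in> events"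
      using event[of "\<lambda>y a z. (y, a) \<in> X"] by simp
  qed simp
  have flip_YA: "\<P>(\<omega> in M. Y \<omega> = y \<and> A \<omega> = a) = \<P>(\<omega> in M. Y \<omega> = flip_labels n y \<and> A \<omega> = a)"
    if y: "y \<in> labels n" for y a
  proof -
    let ?D = "distr M (count_space UNIV) (\<lambda>\<omega>. (Y \<omega>, A \<omega>))"
    have "\<P>(\<omega> in M. Y \<omega> = y \<and> A \<omega> = a) = measure ?D {(y, a)}"
      by (subst measure_distr[OF pair]) (auto intro!: arg_cong[where f = prob])
    also have "\<dots> = measure (distr ?D (count_space UNIV) (map_prod (flip_labels n) id)) {(y, a)}"
      unfolding law distr_dlsm_law_flip[OF \<open>\<sigma> > 0\<close>] ..
    also have "\<dots> = measure M ((\<lambda>\<omega>. (Y \<omega>, A \<omega>)) -` (map_prod (flip_labels n) id -` {(y, a)}) \<inter> space M)"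
      by (subst measure_distr) (auto simp: measure_distr[OF pair])
    \<comment> \<open>As the flip is an involution on \<open>labels n\<close>, the flip of
      \<open>Y\<close> equals \<open>y\<close> exactly when \<open>Y\<close> equals the flip of
      \<open>y\<close>.\<close>
    also have "\<dots> = \<P>(\<omega> in M. Y \<omega> = flip_labels n y \<and> A \<omega> = a)"
      using flip_labels_flip_labels y in_labels(1) by (intro arg_cong[where f = prob]) force
    finally show ?thesis .
  qed
  have flip_joint: "\<P>(\<omega> in M. Y \<omega> = y \<and> Yhat \<omega> = z \<and> A \<omega> = a) =
      \<P>(\<omega> in M. Y \<omega> = flip_labels n y \<and> Yhat \<omega> = z \<and> A \<omega> = a)" if y: "y \<in> labels n" for y z a
  \<comment> \<open>On a graph of probability 0 the conditional probabilities are 0 by division by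
    zero and carry no information, but both joint probabilities vanish by monotonicity.\<close>
  proof (cases "\<P>(\<omega> in M. A \<omega> = a) = 0")
    case True
    have "\<P>(\<omega> in M. Y \<omega> = y' \<and> Yhat \<omega> = z \<and> A \<omega> = a) \<le> \<P>(\<omega> in M. A \<omega> = a)" for y'
      using event[of "\<lambda>y b z. b = a"] by (intro finite_measure_mono) auto
    then show ?thesis using True by (simp add: measure_le_0_iff)
  next
    case False
    \<comment> \<open>The Markov property isolates the factor for \<open>Yhat\<close> given
      \<open>A\<close>, which does not involve \<open>y'\<close>; hence the symmetry of (Y, A)
      carries over to the triple.\<close>
    have "\<P>(\<omega> in M. (Y \<omega> = y' \<and> Yhat \<omega> = z) \<and> A \<omega> = a) / \<P>(\<omega> in M. A \<omega> = a) =
        \<P>(\<omega> in M. Y \<omega> = y' \<and> A \<omega> = a) / \<P>(\<omega> in M. A \<omega> = a) * \<P>(\<omega> in M. Yhat \<omega> = z \<bar> A \<omega> = a)" for y'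
      using assms(10) unfolding markov_chain_def cond_prob_def by blast
    then show ?thesis
      using flip_YA[OF y, of a] False by (simp add: conj_assoc)
  qed
  have flip_YYhat: "\<P>(\<omega> in M. Y \<omega> = y \<and> Yhat \<omega> = z) = \<P>(\<omega> in M. Y \<omega> = flip_labels n y \<and> Yhat \<omega> = z)"
    if y: "y \<in> labels n" for y z
  proof -
    have "\<P>(\<omega> in M. Y \<omega> = y' \<and> Yhat \<omega> = z) =
        (\<Sum>a\<in>graphs n. \<P>(\<omega> in M. Y \<omega> = y' \<and> Yhat \<omega> = z \<and> A \<omega> = a))" for y'
      using event[of "\<lambda>y a z'. y = y' \<and> z' = z"] event[of "\<lambda>y a' z'. y = y' \<and> z' = z \<and> a' = a" for a]
      by (intro prob_sum) (auto simp: finite_graphs in_labels)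
    then show ?thesis using flip_joint[OF y] by simp
  qed
  have "\<P>(\<omega> in M. Yhat \<omega> = Y \<omega>) = (\<Sum>y\<in>labels n. \<P>(\<omega> in M. Y \<omega> = y \<and> Yhat \<omega> = y))"
    using event[of "\<lambda>y a z. z = y"] event[of "\<lambda>y a z. y = u \<and> z = u" for u]
    by (intro prob_sum) (auto simp: finite_labels in_labels)
  also have "\<dots> = (\<Sum>y\<in>labels n. \<P>(\<omega> in M. Y \<omega> = flip_labels n y \<and> Yhat \<omega> = y))"
    by (intro sum.cong refl flip_YYhat)
  \<comment> \<open>The summation index is now the value of \<open>Yhat\<close> only, so the
    disjoint events add up to the estimator being wrong by exactly the global sign.\<close>
  also have "\<dots> = \<P>(\<omega> in M. Y \<omega> = flip_labels n (Yhat \<omega>))"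
    using event[of "\<lambda>y a z. y = flip_labels n z"] event[of "\<lambda>y a z. y = flip_labels n u \<and> z = u" for u]
    by (intro prob_sum[symmetric]) (auto simp: finite_labels in_labels)
  also have "\<dots> \<le> \<P>(\<omega> in M. Yhat \<omega> \<noteq> Y \<omega>)"
    using event[of "\<lambda>y a z. z \<noteq> y"] flip_labels_neq[of _ n] in_labels(2) \<open>n \<ge> 2\<close>
    by (intro finite_measure_mono) force+
  finally have "\<P>(\<omega> in M. Yhat \<omega> = Y \<omega>) \<le> \<P>(\<omega> in M. Yhat \<omega> \<noteq> Y \<omega>)" .
  moreover have "\<P>(\<omega> in M. Yhat \<omega> \<noteq> Y \<omega>) = 1 - \<P>(\<omega> in M. Yhat \<omega> = Y \<omega>)"
    using event[of "\<lambda>y a z. z = y"] by (rule prob_neg)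
  ultimately show ?thesis by simp
qed

end
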